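(* Let $n\ge 1$, let $\lambda_1\ge\lambda_2\ge\dots\ge\lambda_n$ be nonzero real numbers (possibly repeated) with $\lambda_1>0$, and let $x^0\in\mathbb{R}^n$ with $x^0_i\ge 0$ for all $i$. Consider the problem $$\min_{x\in\mathbb{R}^n}\ \|x-x^0\|_2^2\quad\text{s.t.}\quad \sum_{i=1}^n\lambda_i x_i^2-1=0 .\qquad (P)$$ Then there is an optimal solution of (P) in the set $\{x(\mu^* )\}\cup X^{\mathrm d}$, where: - $\mu^*$ is the unique root of $f$ on $\mathcal I=\,]e_1,e_2[$, and $x(\mu^* )=(I+\mu^*D)^{-1}x^0$ (the element $x(\mu^* )$ is omitted from the set if $f$ has no root on $\mathcal I$, or if $\mu^*=-1/\lambda_i$ for some $i$, in which case the inverse does not exist); - $X^{\mathrm d}$ is the finite set of all points $x^{\mathrm d}_k$, $k\in\{1,\dots,|\overline\lambda|\}$, that are defined (see context).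
   Context: $D=\mathrm{diag}(\lambda_1,\dots,\lambda_n)$ and $I_n:=\{1,\dots,n\}$. The function $f$ is the extended-real-valued function $$f(\mu)=\sum_{i:\,x^0_i\neq 0}\lambda_i\left(\frac{x^0_i}{1+\mu\lambda_i}\right)^2-1 .$$ The endpoints of $\mathcal I$ are $$e_1=\max_{\{i:\ \lambda_i>0,\ x^0_i\ne0\}}-\frac1{\lambda_i},\qquad e_2=\min_{\{i:\ \lambda_i<0,\ x^0_i\ne0\}}-\frac1{\lambda_i},$$ with $e_1:=-\infty$ (resp. $e_2:=+\infty$) if the corresponding index set is empty. Let $\overline\lambda=(\overline\lambda_1,\overline\lambda_2,\dots)$ be the vector of distinct values among $\lambda_1,\dots,\lambda_n$, sorted in descending order, and $|\overline\lambda|$ its length. For each $k$ let $L_k=\{i\in I_n:\lambda_i=\overline\lambda_k\}$, $K_k=\{i\in I_n:\lambda_i=\overline\lambda_k,\ x^0_i=0\}$. The point $x^{\mathrm d}_k$ is defined if and only if $K_k=L_k$ and $$r_k:=\frac1{\overline\lambda_k}\left(1-\sum_{j\in I_n\setminus K_k}\lambda_j\left(\frac{x^0_j}{1-\lambda_j/\overline\lambda_k}\right)^2\right)\ge 0 ;$$ in that case, with $k'=\min K_k$, its components are $(x^{\mathrm d}_k)_i=\dfrac{x^0_i}{1-\lambda_i/\overline\lambda_k}$ for $i\notin K_k$, $(x^{\mathrm d}_k)_{k'}=\sqrt{r_k}$, and $(x^{\mathrm d}_k)_i=0$ for $i\in K_k$, $i\ne k'$. *)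

theory Defs
  imports "HOL-Analysis.Analysis"
begin

text \<open>
  The index set \<open>I\<^sub>n = {1,\<dots>,n}\<close> with \<open>n \<ge> 1\<close> is rendered as an arbitrary finite linearly
  ordered type \<open>'n\<close>; the order is needed for the sorting of the eigenvalues and for
  \<open>min K\<^sub>k\<close>. The first index is \<open>Min UNIV\<close>.
\<close>

definition diag_matrix :: "real ^ 'n \<Rightarrow> real ^ 'n ^ 'n" where
  "diag_matrix lam = (\<chi> i j. if i = j then lam $ i else 0)"

definition feasible :: "real ^ 'n \<Rightarrow> (real ^ 'n) set" where
  "feasible lam = {x. (\<Sum>i\<in>UNIV. lam $ i * (x $ i)\<^sup>2) - 1 = 0}"

definition optimal_solution :: "real ^ 'n \<Rightarrow> real ^ 'n \<Rightarrow> real ^ 'n \<Rightarrow> bool" where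
  "optimal_solution lam x0 x \<longleftrightarrow> is_arg_min (\<lambda>y. (norm (y - x0))\<^sup>2) (\<lambda>y. y \<in> feasible lam) x"

text \<open>
  At a pole the division by zero in \<^typ>\<open>ereal\<close> makes the corresponding summand
  \<open>\<plusminus>\<infinity>\<close>, with the sign of \<open>\<lambda>\<^sub>i\<close> (at most one sign occurs for a given \<open>\<mu>\<close>).
\<close>

definition f_fun :: "real ^ 'n \<Rightarrow> real ^ 'n \<Rightarrow> real \<Rightarrow> ereal" where
  "f_fun lam x0 \<mu> =
     (\<Sum>i | x0 $ i \<noteq> 0. ereal (lam $ i) * (ereal (x0 $ i) / ereal (1 + \<mu> * lam $ i))\<^sup>2) - 1"

definition e1 :: "real ^ 'n \<Rightarrow> real ^ 'n \<Rightarrow> ereal" where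
  "e1 lam x0 =
     (let A = {i. lam $ i > 0 \<and> x0 $ i \<noteq> 0} in
      if A = {} then -\<infinity> else ereal (Max ((\<lambda>i. - (1 / lam $ i)) ` A)))"

definition e2 :: "real ^ 'n \<Rightarrow> real ^ 'n \<Rightarrow> ereal" where
  "e2 lam x0 =
     (let A = {i. lam $ i < 0 \<and> x0 $ i \<noteq> 0} in
      if A = {} then \<infinity> else ereal (Min ((\<lambda>i. - (1 / lam $ i)) ` A)))"

definition I_interval :: "real ^ 'n \<Rightarrow> real ^ 'n \<Rightarrow> real set" where
  "I_interval lam x0 = {\<mu>. e1 lam x0 < ereal \<mu> \<and> ereal \<mu> < e2 lam x0}"

definition is_root_on_I :: "real ^ 'n \<Rightarrow> real ^ 'n \<Rightarrow> real \<Rightarrow> bool" where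
  "is_root_on_I lam x0 \<mu> \<longleftrightarrow> \<mu> \<in> I_interval lam x0 \<and> f_fun lam x0 \<mu> = 0"

definition x_of :: "real ^ 'n \<Rightarrow> real ^ 'n \<Rightarrow> real \<Rightarrow> real ^ 'n" where
  "x_of lam x0 \<mu> = matrix_inv (mat 1 + \<mu> *\<^sub>R diag_matrix lam) *v x0"

text \<open>
  The set containing \<open>x(\<mu>\<^sup>*)\<close>, empty when that point is omitted. The uniqueness of the root
  \<open>\<mu>\<^sup>*\<close> is not built into this definition.
\<close>

definition X_root :: "real ^ 'n \<Rightarrow> real ^ 'n \<Rightarrow> (real ^ 'n) set" where
  "X_root lam x0 =
     {x_of lam x0 \<mu> | \<mu>. is_root_on_I lam x0 \<mu> \<and> (\<forall>i. \<mu> \<noteq> - (1 / lam $ i))}"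

text \<open>Positions in the list of distinct values, and hence \<open>k\<close> below, are counted from 0.\<close>

definition lam_bar :: "real ^ 'n \<Rightarrow> real list" where
  "lam_bar lam = rev (sorted_list_of_set (range (\<lambda>i. lam $ i)))"

definition L_set :: "real ^ 'n \<Rightarrow> nat \<Rightarrow> 'n set" where
  "L_set lam k = {i. lam $ i = lam_bar lam ! k}"

definition K_set :: "real ^ 'n \<Rightarrow> real ^ 'n \<Rightarrow> nat \<Rightarrow> 'n set" where
  "K_set lam x0 k = {i. lam $ i = lam_bar lam ! k \<and> x0 $ i = 0}"

definition r_val :: "real ^ 'n \<Rightarrow> real ^ 'n \<Rightarrow> nat \<Rightarrow> real" where
  "r_val lam x0 k =
     1 / (lam_bar lam ! k) *
       (1 - (\<Sum>j\<in>UNIV - K_set lam x0 k.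
               lam $ j * (x0 $ j / (1 - lam $ j / (lam_bar lam ! k)))\<^sup>2))"

definition xd_defined :: "real ^ 'n \<Rightarrow> real ^ 'n \<Rightarrow> nat \<Rightarrow> bool" where
  "xd_defined lam x0 k \<longleftrightarrow> K_set lam x0 k = L_set lam k \<and> r_val lam x0 k \<ge> 0"

definition xd :: "real ^ 'n::{finite,linorder} \<Rightarrow> real ^ 'n::{finite,linorder} \<Rightarrow> nat \<Rightarrow> real ^ 'n::{finite,linorder}" where
  "xd lam x0 k =
     (\<chi> i. if i \<notin> K_set lam x0 k then x0 $ i / (1 - lam $ i / (lam_bar lam ! k))
           else if i = Min (K_set lam x0 k) then sqrt (r_val lam x0 k)
           else 0)"

definition X_d :: "real ^ 'n::{finite,linorder} \<Rightarrow> real ^ 'n::{finite,linorder} \<Rightarrow> (real ^ 'n::{finite,linorder}) set" where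
  "X_d lam x0 = {xd lam x0 k | k. k < length (lam_bar lam) \<and> xd_defined lam x0 k}"

end

theory Submission
  imports Defs
begin

text \<open>
  The constraint set is closed, and nonempty because \<open>\<lambda>\<^sub>1 > 0\<close>, so a nearest point \<open>x\<close> to \<open>x\<^sup>0\<close> exists. On the
  constraint set the gradient \<open>2Dx\<close> does not vanish (its inner product with \<open>x\<close> is \<open>2\<close>), so there
  is a Lagrange multiplier \<open>\<mu>\<close>, that is,
  \<open>(1 + \<mu> \<lambda>\<^sub>i) x\<^sub>i = x\<^sup>0\<^sub>i\<close> for all \<open>i\<close>. It remains to see where such an \<open>x\<close> lies
  (\<open>regular_multiplier\<close> and \<open>pole_multiplier\<close>).

  If no factor \<open>1 + \<mu> \<lambda>\<^sub>i\<close> is zero, then \<open>x = x(\<mu>)\<close> and feasibility of \<open>x\<close> is the equation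
  \<open>f(\<mu>) = 0\<close>. That \<open>\<mu>\<close> lies in the interval \<open>\<I>\<close> means that \<open>1 + \<mu> \<lambda>\<^sub>i > 0\<close> whenever
  \<open>x\<^sup>0\<^sub>i \<noteq> 0\<close>. The positivity comes from a symmetry: flipping the sign
  of a coordinate preserves feasibility, so an optimal \<open>x\<close> has \<open>x\<^sub>i \<ge> 0\<close> where
  \<open>x\<^sup>0\<^sub>i > 0\<close>, and then \<open>(1 + \<mu> \<lambda>\<^sub>i) x\<^sub>i = x\<^sup>0\<^sub>i > 0\<close> forces the factor to be positive.

  If some factor is zero, then \<open>\<mu> = -1/\<lambda>\<close> for one of the distinct values
  \<open>\<lambda>\<close>, and \<open>x\<^sup>0\<close> vanishes on the eigenspace of \<open>\<lambda>\<close>. Both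
  the constraint and the objective see the part of \<open>x\<close> in that eigenspace only through its squared
  length, which is \<open>r\<^sub>k\<close>. Rotating this part onto a single coordinate axis therefore
  gives another optimal solution, and this is \<open>x\<^sup>d\<^sub>k\<close>.

  The root of \<open>f\<close> is unique because, on \<open>\<I>\<close>, every summand of \<open>f\<close> is strictly
  decreasing in \<open>\<mu>\<close>; without summands \<open>f\<close> is the constant \<open>-1\<close> and has no root.
\<close>

section \<open>The secular function on the interval\<close>

lemma I_interval_iff:
  assumes nz: "\<And>i. lam $ i \<noteq> 0"
  shows "\<mu> \<in> I_interval lam x0 \<longleftrightarrow> (\<forall>i. x0 $ i \<noteq> 0 \<longrightarrow> 1 + \<mu> * lam $ i > 0)"
proof -
  have pos: "- (1 / lam $ i) < \<mu> \<longleftrightarrow> 1 + \<mu> * lam $ i > 0" if "lam $ i > 0" for i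
    using that by (auto simp: field_simps)
  have neg: "\<mu> < - (1 / lam $ i) \<longleftrightarrow> 1 + \<mu> * lam $ i > 0" if "lam $ i < 0" for i
    using that by (auto simp: field_simps)
  have "e1 lam x0 < ereal \<mu> \<longleftrightarrow> (\<forall>i. lam $ i > 0 \<and> x0 $ i \<noteq> 0 \<longrightarrow> - (1 / lam $ i) < \<mu>)"
    unfolding e1_def Let_def by (auto simp: Max_less_iff)
  moreover have "ereal \<mu> < e2 lam x0 \<longleftrightarrow> (\<forall>i. lam $ i < 0 \<and> x0 $ i \<noteq> 0 \<longrightarrow> \<mu> < - (1 / lam $ i))"
    unfolding e2_def Let_def by (auto simp: Min_gr_iff)
  moreover have "lam $ i > 0 \<or> lam $ i < 0" for i
    using nz[of i] by linarith
  ultimately show ?thesis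
    unfolding I_interval_def using pos neg by blast
qed

lemma f_fun_eq_real:
  assumes "\<And>i. x0 $ i \<noteq> 0 \<Longrightarrow> 1 + \<mu> * lam $ i \<noteq> 0"
  shows "f_fun lam x0 \<mu> =
    ereal ((\<Sum>i | x0 $ i \<noteq> 0. lam $ i * (x0 $ i / (1 + \<mu> * lam $ i))\<^sup>2) - 1)"
proof -
  have "(\<Sum>i | x0 $ i \<noteq> 0. ereal (lam $ i) * (ereal (x0 $ i) / ereal (1 + \<mu> * lam $ i))\<^sup>2) =
      (\<Sum>i | x0 $ i \<noteq> 0. ereal (lam $ i * (x0 $ i / (1 + \<mu> * lam $ i))\<^sup>2))"
  proof (rule sum.cong)
    fix i assume "i \<in> {i. x0 $ i \<noteq> 0}"
    then have "ereal (x0 $ i) / ereal (1 + \<mu> * lam $ i) = ereal (x0 $ i / (1 + \<mu> * lam $ i))"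
      using assms[of i] by simp
    then show "ereal (lam $ i) * (ereal (x0 $ i) / ereal (1 + \<mu> * lam $ i))\<^sup>2 =
        ereal (lam $ i * (x0 $ i / (1 + \<mu> * lam $ i))\<^sup>2)"
      by (simp add: power2_eq_square)
  qed simp
  then show ?thesis
    unfolding f_fun_def by (simp add: one_ereal_def)
qed

text \<open>
  For \<open>l > 0\<close> the denominator grows with the parameter and for \<open>l < 0\<close> it shrinks, but the
  sign of the leading factor \<open>l\<close> makes the term decrease in both cases.
\<close>

lemma secular_term_strict_decreasing:
  fixes l a \<mu> \<nu> :: real
  assumes "l \<noteq> 0" "a \<noteq> 0" "1 + \<mu> * l > 0" "1 + \<nu> * l > 0" "\<mu> < \<nu>"
  shows "l * (a / (1 + \<nu> * l))\<^sup>2 < l * (a / (1 + \<mu> * l))\<^sup>2"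
proof -
  have shrink: "(a / t)\<^sup>2 < (a / s)\<^sup>2" if "0 < s" "s < t" for s t :: real
  proof -
    have "s\<^sup>2 < t\<^sup>2"
      using that by (simp add: power_strict_mono)
    then show ?thesis
      using that assms(2) by (simp add: power_divide divide_strict_left_mono)
  qed
  consider "l > 0" | "l < 0"
    using assms(1) by linarith
  then show ?thesis
  proof cases
    case 1
    then show ?thesis
      using shrink[of "1 + \<mu> * l" "1 + \<nu> * l"] assms by simp
  next
    case 2
    then show ?thesis
      using shrink[of "1 + \<nu> * l" "1 + \<mu> * l"] assms by simp
  qed
qed

lemma root_on_I_unique:
  assumes nz: "\<And>i. lam $ i \<noteq> 0"
  shows "\<exists>\<^sub>\<le>\<^sub>1 \<mu>. is_root_on_I lam x0 \<mu>"
proof (rule Uniq_I)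
  let ?A = "{i. x0 $ i \<noteq> 0}"
  let ?s = "\<lambda>\<mu>. \<Sum>i\<in>?A. lam $ i * (x0 $ i / (1 + \<mu> * lam $ i))\<^sup>2"
  have root: "?s \<mu> = 1" "\<And>i. i \<in> ?A \<Longrightarrow> 1 + \<mu> * lam $ i > 0" if "is_root_on_I lam x0 \<mu>" for \<mu>
  proof -
    show pos: "\<And>i. i \<in> ?A \<Longrightarrow> 1 + \<mu> * lam $ i > 0"
      using that I_interval_iff[of lam, OF nz] by (auto simp: is_root_on_I_def)
    have "f_fun lam x0 \<mu> = ereal (?s \<mu> - 1)"
      using pos by (intro f_fun_eq_real) force
    then show "?s \<mu> = 1"
      using that by (simp add: is_root_on_I_def)
  qed
  have False if "is_root_on_I lam x0 \<mu>" "is_root_on_I lam x0 \<nu>" "\<mu> < \<nu>" for \<mu> \<nu>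
  proof -
    have "?A \<noteq> {}"
    proof
      assume "?A = {}"
      then have "?s \<mu> = 0" by (simp only: sum.empty)
      then show False using root(1)[OF that(1)] by linarith
    qed
    then have "?s \<nu> < ?s \<mu>"
      using that root(2) nz
      by (intro sum_strict_mono secular_term_strict_decreasing) auto
    then show False
      using root(1) that by simp
  qed
  then show "\<mu> = \<nu>" if "is_root_on_I lam x0 \<mu>" "is_root_on_I lam x0 \<nu>" for \<mu> \<nu>
    using that by (meson linorder_less_linear)
qed

section \<open>Optimal solutions and their multipliers\<close>

lemma feasible_iff: "x \<in> feasible lam \<longleftrightarrow> (\<Sum>i\<in>UNIV. lam $ i * (x $ i)\<^sup>2) = 1"
  by (simp add: feasible_def)

lemma optimal_solution_iff:
  "optimal_solution lam x0 x \<longleftrightarrow>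
     x \<in> feasible lam \<and> (\<forall>y \<in> feasible lam. (norm (x - x0))\<^sup>2 \<le> (norm (y - x0))\<^sup>2)"
  unfolding optimal_solution_def is_arg_min_linorder by auto

lemma norm_vec_power2: "(norm x)\<^sup>2 = (\<Sum>i\<in>UNIV. (x $ i)\<^sup>2)" for x :: "real ^ 'n"
  unfolding power2_norm_eq_inner inner_vec_def by (simp add: power2_eq_square)

lemma optimal_solution_exists:
  assumes "lam $ m > 0"
  obtains x where "optimal_solution lam x0 x"
proof -
  have "closed (feasible lam)"
    unfolding feasible_def by (intro closed_Collect_eq continuous_intros)
  moreover have "feasible lam \<noteq> {}"
  proof -
    have "(\<Sum>i\<in>UNIV. lam $ i * ((axis m (1 / sqrt (lam $ m)) :: real ^ 'a) $ i)\<^sup>2) =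
        (\<Sum>i\<in>UNIV. if i = m then 1 else 0)"
      using assms by (intro sum.cong) (auto simp: axis_def power_divide)
    then have "axis m (1 / sqrt (lam $ m)) \<in> feasible lam"
      by (simp add: feasible_iff)
    then show ?thesis by blast
  qed
  ultimately obtain x where "x \<in> feasible lam" "\<And>y. y \<in> feasible lam \<Longrightarrow> dist x0 x \<le> dist x0 y"
    using distance_attains_inf by blast
  then have "optimal_solution lam x0 x"
    unfolding optimal_solution_iff by (auto simp: dist_norm norm_minus_commute power_mono)
  then show thesis by (rule that)
qed

text \<open>
  Along a tangent direction \<open>v\<close> the quadratic form at \<open>x + tv\<close> is \<open>1 + t\<^sup>2 q(v)\<close>, with no linear
  term. Rescaling \<open>x + tv\<close> by the root of this number gives a feasible curve with
  velocity \<open>v\<close> at \<open>x\<close>, along which the squared distance has derivative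
  \<open>2 (x - x\<^sup>0) \<bullet> v\<close>.
\<close>

lemma optimal_orthogonal_to_tangent:
  assumes opt: "optimal_solution lam x0 x"
    and tangent: "(\<Sum>i\<in>UNIV. lam $ i * x $ i * v $ i) = 0"
  shows "(x - x0) \<bullet> v = 0"
proof -
  define q where "q = (\<Sum>i\<in>UNIV. lam $ i * (v $ i)\<^sup>2)"
  define c where "c = (\<lambda>t. 1 / sqrt (1 + t\<^sup>2 * q))"
  define y where "y = (\<lambda>t. c t *\<^sub>R (x + t *\<^sub>R v))"
  define g where "g = (\<lambda>t. (c t)\<^sup>2 * (x \<bullet> x + 2 * t * (x \<bullet> v) + t\<^sup>2 * (v \<bullet> v))
      - 2 * c t * (x \<bullet> x0 + t * (v \<bullet> x0)) + x0 \<bullet> x0)"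
  have qx: "(\<Sum>i\<in>UNIV. lam $ i * (x $ i)\<^sup>2) = 1"
    using opt by (simp add: optimal_solution_iff feasible_iff)
  have g_eq: "(norm (y t - x0))\<^sup>2 = g t" for t
    unfolding y_def g_def power2_norm_eq_inner
    by (simp add: inner_simps inner_commute power2_eq_square algebra_simps)
  have feas: "y t \<in> feasible lam" if "1 + t\<^sup>2 * q > 0" for t
  proof -
    have "(\<Sum>i\<in>UNIV. lam $ i * (y t $ i)\<^sup>2) =
        (\<Sum>i\<in>UNIV. (c t)\<^sup>2 * (lam $ i * (x $ i)\<^sup>2 + 2 * t * (lam $ i * x $ i * v $ i)
          + t\<^sup>2 * (lam $ i * (v $ i)\<^sup>2)))"
      by (intro sum.cong) (auto simp: y_def power2_eq_square algebra_simps)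
    also have "\<dots> = (c t)\<^sup>2 * (1 + t\<^sup>2 * q)"
      by (simp add: sum.distrib qx tangent q_def flip: sum_distrib_left)
    also have "\<dots> = 1"
      using that by (simp add: c_def power_divide)
    finally show ?thesis
      by (simp add: feasible_iff)
  qed
  have der: "DERIV g 0 :> 2 * ((x - x0) \<bullet> v)"
    unfolding g_def c_def
    by (auto intro!: derivative_eq_intros simp: inner_simps inner_commute algebra_simps)
  have "\<forall>\<^sub>F t in at 0. 1 + t\<^sup>2 * q > 0"
  proof (rule order_tendstoD(1))
    show "((\<lambda>t. 1 + t\<^sup>2 * q) \<longlongrightarrow> 1 + 0\<^sup>2 * q) (at 0)"
      by (intro tendsto_intros)
  qed simp
  then obtain d where d: "d > 0" "\<And>t. t \<noteq> 0 \<Longrightarrow> dist t 0 < d \<Longrightarrow> 1 + t\<^sup>2 * q > 0"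
    unfolding eventually_at by auto
  have y0: "y 0 = x"
    by (simp add: y_def c_def)
  have "g 0 \<le> g t" if "\<bar>0 - t\<bar> < d" for t
  proof (cases "t = 0")
    case False
    then have "y t \<in> feasible lam"
      using that d(2) by (intro feas) (simp add: dist_real_def)
    then show ?thesis
      using opt by (simp add: optimal_solution_iff y0 flip: g_eq)
  qed simp
  then have "2 * ((x - x0) \<bullet> v) = 0"
    using DERIV_local_min[OF der d(1)] by blast
  then show ?thesis by simp
qed

lemma optimal_lagrange_multiplier:
  assumes opt: "optimal_solution lam x0 x"
  obtains \<mu> where "\<And>i. (1 + \<mu> * lam $ i) * x $ i = x0 $ i"
proof -
  define \<alpha> where "\<alpha> = (x - x0) \<bullet> x"
  have qx: "(\<Sum>i\<in>UNIV. lam $ i * (x $ i)\<^sup>2) = 1"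
    using opt by (simp add: optimal_solution_iff feasible_iff)
  have "(1 + - \<alpha> * lam $ i) * x $ i = x0 $ i" for i
  proof -
    \<comment> \<open>Since \<open>Dx \<bullet> x = 1\<close>, subtracting \<open>(Dx \<bullet> w) x\<close> projects \<open>w\<close> onto the tangent space.\<close>
    define v where "v = axis i 1 - (lam $ i * x $ i) *\<^sub>R x"
    have "(\<Sum>j\<in>UNIV. lam $ j * x $ j * v $ j) =
        (\<Sum>j\<in>UNIV. (if j = i then lam $ j * x $ j else 0)
          - (lam $ i * x $ i) * (lam $ j * (x $ j)\<^sup>2))"
      by (intro sum.cong) (auto simp: v_def axis_def power2_eq_square algebra_simps)
    also have "\<dots> = 0"
      by (simp add: sum_subtractf qx flip: sum_distrib_left)
    finally have "(x - x0) \<bullet> v = 0"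
      by (rule optimal_orthogonal_to_tangent[OF opt])
    then have "x $ i - x0 $ i = lam $ i * x $ i * \<alpha>"
      by (simp add: v_def \<alpha>_def inner_diff_right inner_axis)
    then show ?thesis
      by (simp add: algebra_simps)
  qed
  then show thesis by (rule that)
qed

text \<open>Otherwise flipping the sign of the coordinate would bring the point closer to \<open>x\<^sup>0\<close>.\<close>

lemma optimal_nonneg:
  assumes opt: "optimal_solution lam x0 x" and "x0 $ i > 0"
  shows "x $ i \<ge> 0"
proof (rule ccontr)
  assume neg: "\<not> x $ i \<ge> 0"
  define y where "y = (\<chi> j. if j = i then - x $ j else x $ j)"
  have "(\<Sum>j\<in>UNIV. lam $ j * (y $ j)\<^sup>2) = (\<Sum>j\<in>UNIV. lam $ j * (x $ j)\<^sup>2)"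
    by (intro sum.cong) (auto simp: y_def)
  then have "y \<in> feasible lam"
    using opt by (simp add: optimal_solution_iff feasible_iff)
  then have "(norm (x - x0))\<^sup>2 \<le> (norm (y - x0))\<^sup>2"
    using opt by (simp add: optimal_solution_iff)
  moreover have "(norm (y - x0))\<^sup>2 < (norm (x - x0))\<^sup>2"
    unfolding norm_vec_power2
  proof (rule sum_strict_mono_ex1)
    have "x $ i * x0 $ i < 0"
      using neg assms(2) by (simp add: mult_neg_pos)
    then have *: "((y - x0) $ i)\<^sup>2 < ((x - x0) $ i)\<^sup>2"
      by (simp add: y_def power2_eq_square algebra_simps)
    then show "\<exists>j\<in>UNIV. ((y - x0) $ j)\<^sup>2 < ((x - x0) $ j)\<^sup>2" by blast
    show "\<forall>j\<in>UNIV. ((y - x0) $ j)\<^sup>2 \<le> ((x - x0) $ j)\<^sup>2"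
      using * by (auto simp: y_def)
  qed simp
  ultimately show False by linarith
qed

section \<open>Locating an optimal solution\<close>

lemma x_of_eqI:
  assumes "\<And>i. 1 + \<mu> * lam $ i \<noteq> 0"
    and stat: "\<And>i. (1 + \<mu> * lam $ i) * x $ i = x0 $ i"
  shows "x_of lam x0 \<mu> = x"
proof -
  let ?A = "mat 1 + \<mu> *\<^sub>R diag_matrix lam"
  have A: "?A = (\<chi> i j. if i = j then 1 + \<mu> * lam $ i else 0)"
    by (auto simp: vec_eq_iff mat_def diag_matrix_def)
  have act: "(?A *v z) $ i = (1 + \<mu> * lam $ i) * z $ i" for z i
    unfolding A matrix_vector_mult_def by (simp add: if_distrib[of "\<lambda>b. b * _"] cong: if_cong)
  have "z = 0" if "?A *v z = 0" for z
    using that act[of z] assms(1) by (simp add: vec_eq_iff)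
  then have "\<exists>B. B ** ?A = mat 1"
    using matrix_left_invertible_ker[of ?A] by blast
  then have "invertible ?A"
    by (simp add: invertible_left_inverse)
  then have inv: "matrix_inv ?A ** ?A = mat 1"
    unfolding invertible_def matrix_inv_def by (rule someI2_ex) blast
  have "?A *v x = x0"
    using act stat by (simp add: vec_eq_iff)
  then have "matrix_inv ?A *v x0 = (matrix_inv ?A ** ?A) *v x"
    by (simp flip: matrix_vector_mul_assoc)
  then show ?thesis
    by (simp add: x_of_def inv)
qed

lemma regular_multiplier:
  assumes nz: "\<And>i. lam $ i \<noteq> 0" and nonneg: "\<And>i. x0 $ i \<ge> 0"
    and opt: "optimal_solution lam x0 x"
    and stat: "\<And>i. (1 + \<mu> * lam $ i) * x $ i = x0 $ i"
    and regular: "\<And>i. 1 + \<mu> * lam $ i \<noteq> 0"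
  shows "x \<in> X_root lam x0"
proof -
  have x_eq: "x $ i = x0 $ i / (1 + \<mu> * lam $ i)" for i
    using stat[of i] regular[of i] by (simp add: field_simps)
  have "1 + \<mu> * lam $ i > 0" if "x0 $ i \<noteq> 0" for i
  proof -
    have pos: "x0 $ i > 0"
      using nonneg[of i] that by simp
    then show ?thesis
      using optimal_nonneg[OF opt pos] stat[of i] by (metis zero_less_mult_pos2 mult_zero_right
          less_eq_real_def)
  qed
  then have "\<mu> \<in> I_interval lam x0"
    using I_interval_iff[of lam, OF nz] by blast
  moreover have "f_fun lam x0 \<mu> = 0"
  proof -
    have "(\<Sum>i | x0 $ i \<noteq> 0. lam $ i * (x0 $ i / (1 + \<mu> * lam $ i))\<^sup>2) =
        (\<Sum>i\<in>UNIV. lam $ i * (x $ i)\<^sup>2)"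
      by (rule sum.mono_neutral_cong_left) (auto simp: x_eq)
    then show ?thesis
      using opt regular by (simp add: f_fun_eq_real optimal_solution_iff feasible_iff)
  qed
  moreover have "\<mu> \<noteq> - (1 / lam $ i)" for i
    using regular[of i] nz[of i] by auto
  moreover have "x = x_of lam x0 \<mu>"
    using x_of_eqI[of \<mu> lam x x0] regular stat by simp
  ultimately show ?thesis
    unfolding X_root_def is_root_on_I_def by blast
qed

lemma sum_power2_single_coordinate:
  assumes "finite K" "m \<in> K" "r \<ge> 0"
  shows "(\<Sum>i\<in>K. (if i = m then sqrt r else 0)\<^sup>2) = r"
proof -
  have "(\<Sum>i\<in>K. (if i = m then sqrt r else 0)\<^sup>2) = (\<Sum>i\<in>K. if i = m then r else 0)"
    using assms(3) by (intro sum.cong) auto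
  then show ?thesis
    using assms by simp
qed

text \<open>
  Here \<open>\<mu> = -1/\<lambda>\<^sub>m\<close>. Feasibility of \<open>x\<close> identifies \<open>r\<^sub>k\<close> with the squared length of the
  part of \<open>x\<close> in the eigenspace of \<open>\<lambda>\<^sub>m\<close>, so \<open>x\<^sup>d\<^sub>k\<close> is \<open>x\<close> with that part
  rotated onto one axis. As \<open>x\<^sup>0\<close> vanishes on the eigenspace, neither the constraint nor the
  distance changes.
\<close>

lemma pole_multiplier:
  fixes lam x0 x :: "real ^ 'n::{finite,linorder}"
  assumes nz: "\<And>i. lam $ i \<noteq> 0"
    and opt: "optimal_solution lam x0 x"
    and stat: "\<And>i. (1 + \<mu> * lam $ i) * x $ i = x0 $ i"
    and pole: "1 + \<mu> * lam $ m = 0"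
  shows "\<exists>z \<in> X_d lam x0. optimal_solution lam x0 z"
proof -
  have "lam $ m \<in> set (lam_bar lam)"
    by (simp add: lam_bar_def)
  then obtain k where k: "k < length (lam_bar lam)" and bar: "lam_bar lam ! k = lam $ m"
    by (metis in_set_conv_nth)
  let ?l = "lam $ m" and ?K = "K_set lam x0 k" and ?z = "xd lam x0 k"
  have \<mu>: "\<mu> = - 1 / ?l"
    using pole nz[of m] by (simp add: field_simps)
  have factor: "1 + \<mu> * lam $ i = 1 - lam $ i / ?l" for i
    by (simp add: \<mu>)
  have x0_zero: "x0 $ i = 0" if "lam $ i = ?l" for i
    using stat[of i] that pole by simp
  have K: "?K = {i. lam $ i = ?l}"
    using x0_zero by (auto simp: K_set_def bar)
  have "m \<in> ?K"
    by (simp add: K)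
  then have Min_K: "Min ?K \<in> ?K"
    by (intro Min_in) auto
  have off: "x $ i = x0 $ i / (1 - lam $ i / ?l)" if "i \<notin> ?K" for i
  proof -
    have "1 - lam $ i / ?l \<noteq> 0"
      using that nz[of m] by (simp add: K field_simps)
    then show ?thesis
      using stat[of i] by (simp add: factor field_simps)
  qed
  have split: "(\<Sum>i\<in>UNIV. h i) = (\<Sum>i\<in>UNIV - ?K. h i) + (\<Sum>i\<in>?K. h i)" for h :: "'n \<Rightarrow> real"
    by (rule sum.subset_diff) auto
  have r: "r_val lam x0 k = (\<Sum>i\<in>?K. (x $ i)\<^sup>2)"
  proof -
    have "(\<Sum>i\<in>UNIV - ?K. lam $ i * (x0 $ i / (1 - lam $ i / ?l))\<^sup>2) =
        (\<Sum>i\<in>UNIV - ?K. lam $ i * (x $ i)\<^sup>2)"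
      by (intro sum.cong) (auto simp: off)
    moreover have "(\<Sum>i\<in>UNIV - ?K. lam $ i * (x $ i)\<^sup>2) + (\<Sum>i\<in>?K. lam $ i * (x $ i)\<^sup>2) = 1"
      using opt by (simp add: optimal_solution_iff feasible_iff flip: split)
    moreover have "(\<Sum>i\<in>?K. lam $ i * (x $ i)\<^sup>2) = ?l * (\<Sum>i\<in>?K. (x $ i)\<^sup>2)"
      unfolding sum_distrib_left by (intro sum.cong) (auto simp: K)
    ultimately have "1 - (\<Sum>i\<in>UNIV - ?K. lam $ i * (x0 $ i / (1 - lam $ i / ?l))\<^sup>2) =
        ?l * (\<Sum>i\<in>?K. (x $ i)\<^sup>2)"
      by linarith
    then show ?thesis
      unfolding r_val_def bar using nz[of m] by simp
  qed
  then have r_nonneg: "r_val lam x0 k \<ge> 0"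
    by (simp add: sum_nonneg)
  have z_off: "?z $ i = x $ i" if "i \<notin> ?K" for i
    using that by (simp add: xd_def bar off)
  have z_on: "(\<Sum>i\<in>?K. (?z $ i)\<^sup>2) = (\<Sum>i\<in>?K. (x $ i)\<^sup>2)"
  proof -
    have "(\<Sum>i\<in>?K. (?z $ i)\<^sup>2) =
        (\<Sum>i\<in>?K. (if i = Min ?K then sqrt (r_val lam x0 k) else 0)\<^sup>2)"
      by (intro sum.cong) (auto simp: xd_def)
    also have "\<dots> = r_val lam x0 k"
      using Min_K r_nonneg by (intro sum_power2_single_coordinate) auto
    finally show ?thesis
      by (simp add: r)
  qed
  have "(\<Sum>i\<in>UNIV. lam $ i * (?z $ i)\<^sup>2) = (\<Sum>i\<in>UNIV. lam $ i * (x $ i)\<^sup>2)"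
  proof -
    have "(\<Sum>i\<in>?K. lam $ i * (w $ i)\<^sup>2) = ?l * (\<Sum>i\<in>?K. (w $ i)\<^sup>2)" for w :: "real ^ 'n::{finite,linorder}"
      unfolding sum_distrib_left by (intro sum.cong) (auto simp: K)
    then have "(\<Sum>i\<in>?K. lam $ i * (?z $ i)\<^sup>2) = (\<Sum>i\<in>?K. lam $ i * (x $ i)\<^sup>2)"
      by (simp add: z_on)
    then show ?thesis
      unfolding split by (simp add: z_off)
  qed
  then have "?z \<in> feasible lam"
    using opt by (simp add: optimal_solution_iff feasible_iff)
  moreover have "(norm (?z - x0))\<^sup>2 = (norm (x - x0))\<^sup>2"
  proof -
    have "(\<Sum>i\<in>?K. ((w - x0) $ i)\<^sup>2) = (\<Sum>i\<in>?K. (w $ i)\<^sup>2)" for w :: "real ^ 'n::{finite,linorder}"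
      using x0_zero by (intro sum.cong) (auto simp: K)
    then have "(\<Sum>i\<in>?K. ((?z - x0) $ i)\<^sup>2) = (\<Sum>i\<in>?K. ((x - x0) $ i)\<^sup>2)"
      by (simp only: z_on)
    then show ?thesis
      unfolding norm_vec_power2 split by (simp add: z_off)
  qed
  ultimately have "optimal_solution lam x0 ?z"
    using opt by (simp add: optimal_solution_iff)
  moreover have "xd_defined lam x0 k"
    using K r_nonneg by (simp add: xd_defined_def L_set_def bar)
  then have "?z \<in> X_d lam x0"
    using k by (auto simp: X_d_def)
  ultimately show ?thesis by blast
qed

theorem proposition2p20:
  fixes lam x0 :: "real ^ 'n::{finite,linorder}"
  assumes "antimono (\<lambda>i. lam $ i)"
    and "\<And>i. lam $ i \<noteq> 0"
    and "lam $ Min UNIV > 0"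
    and "\<And>i. x0 $ i \<ge> 0"
  shows "(\<exists>\<^sub>\<le>\<^sub>1 \<mu>. is_root_on_I lam x0 \<mu>) \<and>
         (\<exists>x \<in> X_root lam x0 \<union> X_d lam x0. optimal_solution lam x0 x)"
proof
  show "\<exists>\<^sub>\<le>\<^sub>1 \<mu>. is_root_on_I lam x0 \<mu>"
    using assms(2) by (rule root_on_I_unique)
  obtain x where opt: "optimal_solution lam x0 x"
    using optimal_solution_exists assms(3) by blast
  obtain \<mu> where stat: "\<And>i. (1 + \<mu> * lam $ i) * x $ i = x0 $ i"
    using optimal_lagrange_multiplier[OF opt] by blast
  show "\<exists>x \<in> X_root lam x0 \<union> X_d lam x0. optimal_solution lam x0 x"
  proof (cases "\<exists>m. 1 + \<mu> * lam $ m = 0")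
    case True
    then show ?thesis
      using pole_multiplier[OF assms(2) opt stat] by blast
  next
    case False
    then have "x \<in> X_root lam x0"
      using regular_multiplier[OF assms(2,4) opt stat] by blast
    then show ?thesis
      using opt by blast
  qed
qed

end
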